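(* Let $d\in\{1,2,3\}$, let $\Omega=[-\pi,\pi]^d$ be the $2\pi$-periodic torus, let $\nu>0$, $\tau>0$, and put $f(u)=u^3-u$. Let $u^0:\Omega\to\mathbb R$ be a bounded (measurable) function with mean zero, and let $(u^n)_{n\ge 0}$ be generated from $u^0$ by the semi-discrete scheme $$\frac{u^{n+1}-u^n}{\tau} = - \nu \Delta^2 u^{n+1} + A \Delta (u^{n+1}-u^n) +\Delta( f(u^n) ), \qquad n\ge 0.$$ Assume $$A\ge A_{cr}:= 1+ 2\sqrt{1+\frac 43\cdot \frac{\nu}{\tau}}.$$ If $\|u^0\|_{\infty} \le M:=\sqrt{\frac{A+1}3}$, then $$\|u^n\|_{\infty} \le M \qquad\text{for all } n \ge 1.$$
   Context: Functions are real-valued on the $2\pi$-periodic torus $\Omega$; $\Delta$ is the Laplacian on the torus, and the scheme is understood in the sense of periodic distributions (given $u^n$, the function $u^{n+1}$ is the unique solution of the linear elliptic equation $(1+\nu\tau\Delta^2-A\tau\Delta)u^{n+1}=u^n-A\tau\Delta u^n+\tau\Delta(f(u^n))$). $\|\cdot\|_\infty$ is the $L^\infty(\Omega)$ norm. Here $\nu$ is the dissipation coefficient, $\tau$ the time step, and $A$ the stabilization parameter. *)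

theory Defs
  imports "HOL-Probability.Essential_Supremum"
begin

(* Functions on the torus (R / 2 pi Z)^d are represented by functions on R^d that are
   2 pi-periodic in every coordinate; integrals and norms are taken over the closed
   fundamental cell [-pi, pi]^d with Lebesgue measure. *)

definition torus_cell :: "(real ^ 'd) set" where
  "torus_cell = cbox (\<chi> i. - pi) (\<chi> i. pi)"

abbreviation torus_measure :: "(real ^ 'd) measure" where
  "torus_measure \<equiv> lebesgue_on torus_cell"

definition torus_periodic :: "(real ^ 'd \<Rightarrow> real) \<Rightarrow> bool" where
  "torus_periodic u \<longleftrightarrow> (\<forall>x i. u (x + (2 * pi) *\<^sub>R axis i 1) = u x)"

definition Linf_norm :: "(real ^ 'd \<Rightarrow> real) \<Rightarrow> ereal" where
  "Linf_norm u = esssup torus_measure (\<lambda>x. ereal \<bar>u x\<bar>)"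

definition pderivative :: "'d::finite \<Rightarrow> (real ^ 'd \<Rightarrow> real) \<Rightarrow> real ^ 'd \<Rightarrow> real" where
  "pderivative i \<phi> x = deriv (\<lambda>t. \<phi> (x + t *\<^sub>R axis i 1)) 0"

definition laplacian :: "(real ^ 'd \<Rightarrow> real) \<Rightarrow> real ^ 'd \<Rightarrow> real" where
  "laplacian \<phi> x = (\<Sum>i\<in>UNIV. pderivative i (pderivative i \<phi>) x)"

(* C^infinity: every iterated partial derivative (the list gives the directions) is
   Frechet differentiable everywhere, hence also continuous. *)
definition smooth_fun :: "(real ^ 'd \<Rightarrow> real) \<Rightarrow> bool" where
  "smooth_fun \<phi> \<longleftrightarrow> (\<forall>is. foldr pderivative is \<phi> differentiable_on UNIV)"

definition test_fun :: "(real ^ 'd \<Rightarrow> real) \<Rightarrow> bool" where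
  "test_fun \<phi> \<longleftrightarrow> smooth_fun \<phi> \<and> torus_periodic \<phi>"

(* Distributions are written as functionals on all functions, but they are only ever
   evaluated and compared on test functions. *)
type_synonym 'd distribution = "(real ^ 'd \<Rightarrow> real) \<Rightarrow> real"

definition dist_of :: "(real ^ 'd \<Rightarrow> real) \<Rightarrow> 'd distribution" where
  "dist_of u \<phi> = (\<integral>x. u x * \<phi> x \<partial>torus_measure)"

definition dist_laplacian :: "'d::finite distribution \<Rightarrow> 'd distribution" where
  "dist_laplacian T \<phi> = T (laplacian \<phi>)"

definition nonlin :: "real \<Rightarrow> real" where
  "nonlin s = s ^ 3 - s"

(* One time step, u being the old and v the new iterate: v is a function in L^1 of the
   torus that satisfies the scheme in the sense of periodic distributions. Asking only for
   L^1 is the least restrictive requirement under which v defines a distribution. *)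
definition scheme_step ::
  "real \<Rightarrow> real \<Rightarrow> real \<Rightarrow> (real ^ 'd \<Rightarrow> real) \<Rightarrow> (real ^ 'd \<Rightarrow> real) \<Rightarrow> bool" where
  "scheme_step \<nu> \<tau> A u v \<longleftrightarrow>
     torus_periodic v \<and> integrable torus_measure v \<and>
     (\<forall>\<phi>. test_fun \<phi> \<longrightarrow>
        (dist_of v \<phi> - dist_of u \<phi>) / \<tau> =
          - \<nu> * dist_laplacian (dist_laplacian (dist_of v)) \<phi>
          + A * dist_laplacian (\<lambda>\<psi>. dist_of v \<psi> - dist_of u \<psi>) \<phi>
          + dist_laplacian (dist_of (\<lambda>x. nonlin (u x))) \<phi>)"

end

theory Submission
  imports Defs
begin

text \<open>
  The condition on \<open>A\<close> is exactly what makes the elliptic operator factor as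
  \<open>1 + \<nu>\<tau>\<Delta>\<^sup>2 - A\<tau>\<Delta> = (1 - a\<Delta>)(1 - b\<Delta>)\<close> with \<open>a, b \<ge> 0\<close> and \<open>\<kappa>(A + 1) \<le> 4/3\<close> for \<open>\<kappa> = \<tau>/b\<close>.
  With \<open>g(s) = As - f(s) = (A + 1)s - s\<^sup>3\<close> and \<open>h(s) = s - \<kappa>g(s)\<close>, one step of the scheme reads
  \<open>v = (1 - a\<Delta>)\<^sup>-\<^sup>1 (\<kappa>g(u) + (1 - b\<Delta>)\<^sup>-\<^sup>1 h(u))\<close>. On \<open>[-M, M]\<close> both \<open>\<bar>g\<bar>\<close> and \<open>\<bar>h\<bar>\<close> are maximal
  at \<open>M\<close>, and \<open>\<kappa>g(M) + h(M) = M\<close>; since the resolvents preserve positivity and constants, the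
  bound \<open>\<bar>u\<bar> \<le> M\<close> is inherited by \<open>v\<close>.

  To avoid constructing the resolvents on distributions, they are moved to the test function:
  it suffices to test \<open>v\<close> against nonnegative trigonometric polynomials \<open>\<psi>\<close>, for which
  \<open>(1 - a\<Delta>)\<eta> = \<psi>\<close> and \<open>(1 - b\<Delta>)\<phi> = \<eta>\<close> are solved by dividing Fourier coefficients, and
  \<open>\<eta>, \<phi> \<ge> 0\<close> because \<open>\<Delta> \<ge> 0\<close> at a minimum.
\<close>

subsection \<open>Trigonometric polynomials\<close>

definition phase :: "int ^ 'd \<Rightarrow> real ^ 'd \<Rightarrow> real" where
  "phase k x = (\<Sum>i\<in>UNIV. real_of_int (k $ i) * x $ i)"

text \<open>The real span of the modes with integer frequencies, closed under sums only: scalars are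
  absorbed into the coefficient of a mode. Any property that respects sums then needs checking on
  one cosine and one sine.\<close>

inductive trig_poly :: "(real ^ 'd \<Rightarrow> real) \<Rightarrow> bool" where
  cos: "trig_poly (\<lambda>x. c * cos (phase k x))"
| sin: "trig_poly (\<lambda>x. c * sin (phase k x))"
| add: "trig_poly f \<Longrightarrow> trig_poly g \<Longrightarrow> trig_poly (\<lambda>x. f x + g x)"

lemma phase_add_left: "phase (k + l) x = phase k x + phase l x"
  by (simp add: phase_def sum.distrib distrib_right)

lemma phase_diff_left: "phase (k - l) x = phase k x - phase l x"
  by (simp add: phase_def sum_subtractf left_diff_distrib)

lemma phase_add_right: "phase k (x + y) = phase k x + phase k y"
  by (simp add: phase_def sum.distrib distrib_left)

lemma phase_scaleR: "phase k (c *\<^sub>R x) = c * phase k x"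
  by (simp add: phase_def sum_distrib_left mult.left_commute)

lemma phase_axis: "phase k (axis i 1) = k $ i"
  by (simp add: phase_def axis_def if_distrib cong: if_cong)

lemma phase_axis_left: "phase (axis i 1) x = x $ i"
  by (simp add: phase_def axis_def if_distrib if_distribR cong: if_cong)

lemma trig_poly_const: "trig_poly (\<lambda>x. c)"
  using trig_poly.cos[of c 0] by (simp add: phase_def)

lemma trig_poly_cmult: "trig_poly f \<Longrightarrow> trig_poly (\<lambda>x. c * f x)"
proof (induction rule: trig_poly.induct)
  case (cos d k)
  then show ?case using trig_poly.cos[of "c * d" k] by (simp add: mult.assoc)
next
  case (sin d k)
  then show ?case using trig_poly.sin[of "c * d" k] by (simp add: mult.assoc)
next
  case (add f g)
  then show ?case using trig_poly.add by (simp add: distrib_left)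
qed

lemma trig_poly_sum:
  "finite I \<Longrightarrow> (\<And>i. i \<in> I \<Longrightarrow> trig_poly (f i)) \<Longrightarrow> trig_poly (\<lambda>x. \<Sum>i\<in>I. f i x)"
  by (induction rule: finite_induct) (auto intro: trig_poly_const trig_poly.add)

text \<open>Product-to-sum formulas on pairs of modes, extended bilinearly by a nested induction.
  Products arise when polynomials in the functions cos and sin of the coordinates are recognised as
  trigonometric polynomials.\<close>

lemma trig_poly_mult:
  assumes "trig_poly f" "trig_poly g"
  shows "trig_poly (\<lambda>x. f x * g x)"
  using assms
proof (induction arbitrary: g rule: trig_poly.induct)
  case (cos c k)
  from cos show ?case
  proof (induction rule: trig_poly.induct)
    case (cos d l)
    have "c * cos (phase k x) * (d * cos (phase l x)) =
        (c * d / 2) * cos (phase (k - l) x) + (c * d / 2) * cos (phase (k + l) x)" for x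
      by (simp add: phase_add_left phase_diff_left cos_add cos_diff sin_add sin_diff field_simps)
    then show ?case by (simp only:) (intro trig_poly.intros)
  next
    case (sin d l)
    have "c * cos (phase k x) * (d * sin (phase l x)) =
        (c * d / 2) * sin (phase (k + l) x) + (- (c * d / 2)) * sin (phase (k - l) x)" for x
      by (simp add: phase_add_left phase_diff_left cos_add cos_diff sin_add sin_diff field_simps)
    then show ?case by (simp only:) (intro trig_poly.intros)
  next
    case (add f g)
    then show ?case by (simp add: distrib_left trig_poly.add)
  qed
next
  case (sin c k)
  from sin show ?case
  proof (induction rule: trig_poly.induct)
    case (cos d l)
    have "c * sin (phase k x) * (d * cos (phase l x)) =
        (c * d / 2) * sin (phase (k + l) x) + (c * d / 2) * sin (phase (k - l) x)" for x
      by (simp add: phase_add_left phase_diff_left cos_add cos_diff sin_add sin_diff field_simps)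
    then show ?case by (simp only:) (intro trig_poly.intros)
  next
    case (sin d l)
    have "c * sin (phase k x) * (d * sin (phase l x)) =
        (c * d / 2) * cos (phase (k - l) x) + (- (c * d / 2)) * cos (phase (k + l) x)" for x
      by (simp add: phase_add_left phase_diff_left cos_add cos_diff sin_add sin_diff field_simps)
    then show ?case by (simp only:) (intro trig_poly.intros)
  next
    case (add f g)
    then show ?case by (simp add: distrib_left trig_poly.add)
  qed
next
  case (add f1 f2)
  then show ?case by (simp add: distrib_right trig_poly.add)
qed

text \<open>An integer vector has integer phase, so the argument of each mode moves by a multiple of
  2 pi. General \<open>m\<close> is allowed because the minimum argument translates by arbitrary
  lattice vectors.\<close>

lemma trig_poly_translate:
  "trig_poly f \<Longrightarrow> (\<And>i. m $ i \<in> \<int>) \<Longrightarrow> f (x + (2 * pi) *\<^sub>R m) = f x"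
proof (induction rule: trig_poly.induct)
  case (cos c k)
  have "phase k m \<in> \<int>" by (auto simp: phase_def intro!: Ints_sum Ints_mult cos)
  then show ?case by (auto elim!: Ints_cases simp: phase_add_right phase_scaleR cos_add)
next
  case (sin c k)
  have "phase k m \<in> \<int>" by (auto simp: phase_def intro!: Ints_sum Ints_mult sin)
  then show ?case by (auto elim!: Ints_cases simp: phase_add_right phase_scaleR sin_add)
qed auto

section \<open>Differentiation of trigonometric polynomials\<close>

lemma bounded_linear_phase: "bounded_linear (phase k)"
  by (simp add: linear_conv_bounded_linear[symmetric] linear_iff phase_add_right phase_scaleR)

lemma trig_poly_differentiable: "trig_poly f \<Longrightarrow> f differentiable (at x)"
proof (induction rule: trig_poly.induct)
  case (cos c k)
  have *: "(phase k has_derivative phase k) (at x)"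
    by (rule bounded_linear_imp_has_derivative[OF bounded_linear_phase])
  show ?case
    unfolding differentiable_def by (rule exI) (rule derivative_eq_intros * refl)+
next
  case (sin c k)
  have *: "(phase k has_derivative phase k) (at x)"
    by (rule bounded_linear_imp_has_derivative[OF bounded_linear_phase])
  show ?case
    unfolding differentiable_def by (rule exI) (rule derivative_eq_intros * refl)+
qed auto

lemma trig_poly_continuous_on: "trig_poly f \<Longrightarrow> continuous_on S f"
  by (meson continuous_at_imp_continuous_on differentiable_imp_continuous_within trig_poly_differentiable)

text \<open>\<open>pderivative\<close> is a derivative at parameter 0 only; moving the base point
  along the axis gives it at every \<open>t\<close>. Restrictions to coordinate lines thus become
  differentiable functions of one variable, as the second-derivative test requires.\<close>

lemma trig_poly_has_derivative_axis:
  assumes "trig_poly f"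
  shows "((\<lambda>t. f (x + t *\<^sub>R axis i 1)) has_real_derivative pderivative i f (x + t *\<^sub>R axis i 1)) (at t)"
proof -
  let ?l = "\<lambda>x t. x + t *\<^sub>R axis i (1::real)"
  have diff: "(\<lambda>t. f (?l x t)) differentiable (at t)" for x t
    by (rule differentiable_compose[of f "?l x"])
      (auto intro!: trig_poly_differentiable assms derivative_intros)
  have "deriv (\<lambda>s. f (?l (?l x t) s)) 0 = deriv (\<lambda>s. f (?l x s)) t"
  proof -
    have "((\<lambda>s. f (?l x s)) has_real_derivative deriv (\<lambda>s. f (?l x s)) t) (at (0 + t))"
      using diff by (simp add: DERIV_deriv_iff_real_differentiable)
    then have "((\<lambda>s. f (?l x (s + t))) has_real_derivative deriv (\<lambda>s. f (?l x s)) t) (at 0)"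
      by (subst (asm) DERIV_shift) (simp add: add.commute)
    then have "((\<lambda>s. f (?l (?l x t) s)) has_real_derivative deriv (\<lambda>s. f (?l x s)) t) (at 0)"
      by (simp add: scaleR_add_left add_ac)
    then show ?thesis by (rule DERIV_imp_deriv)
  qed
  then show ?thesis
    using diff by (simp add: pderivative_def DERIV_deriv_iff_real_differentiable)
qed

lemma pderivative_eqI:
  "(\<And>x. ((\<lambda>t. f (x + t *\<^sub>R axis i 1)) has_real_derivative f' x) (at 0)) \<Longrightarrow> pderivative i f = f'"
  by (auto simp: pderivative_def fun_eq_iff intro!: DERIV_imp_deriv)

lemma pderivative_cos:
  "pderivative i (\<lambda>x. c * cos (phase k x)) = (\<lambda>x. (- c * k $ i) * sin (phase k x))"
  by (rule pderivative_eqI)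
    (auto simp: phase_add_right phase_scaleR phase_axis intro!: derivative_eq_intros)

lemma pderivative_sin:
  "pderivative i (\<lambda>x. c * sin (phase k x)) = (\<lambda>x. (c * k $ i) * cos (phase k x))"
  by (rule pderivative_eqI)
    (auto simp: phase_add_right phase_scaleR phase_axis intro!: derivative_eq_intros)

lemma pderivative_add:
  assumes "trig_poly f" "trig_poly g"
  shows "pderivative i (\<lambda>x. f x + g x) = (\<lambda>x. pderivative i f x + pderivative i g x)"
  by (rule pderivative_eqI)
    (use trig_poly_has_derivative_axis[OF assms(1), of _ i 0]
       trig_poly_has_derivative_axis[OF assms(2), of _ i 0] in \<open>auto intro: DERIV_add\<close>)

lemma pderivative_cmult:
  assumes "trig_poly f"
  shows "pderivative i (\<lambda>x. c * f x) = (\<lambda>x. c * pderivative i f x)"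
  by (rule pderivative_eqI)
    (use trig_poly_has_derivative_axis[OF assms(1), of _ i 0] in \<open>auto intro: DERIV_cmult\<close>)

lemma trig_poly_pderivative: "trig_poly f \<Longrightarrow> trig_poly (pderivative i f)"
  by (induction rule: trig_poly.induct)
    (auto simp only: pderivative_cos pderivative_sin pderivative_add intro: trig_poly.intros)

lemma trig_poly_laplacian: "trig_poly f \<Longrightarrow> trig_poly (laplacian f)"
  unfolding laplacian_def[abs_def] by (intro trig_poly_sum trig_poly_pderivative) auto

lemma laplacian_add:
  "trig_poly f \<Longrightarrow> trig_poly g \<Longrightarrow> laplacian (\<lambda>x. f x + g x) = (\<lambda>x. laplacian f x + laplacian g x)"
  by (simp add: laplacian_def[abs_def] pderivative_add trig_poly_pderivative sum.distrib)

lemma laplacian_cmult: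
  "trig_poly f \<Longrightarrow> laplacian (\<lambda>x. c * f x) = (\<lambda>x. c * laplacian f x)"
  by (simp add: laplacian_def[abs_def] pderivative_cmult trig_poly_pderivative sum_distrib_left)

text \<open>Closure under \<open>pderivative\<close> handles all iterated partial derivatives at
  once, so trigonometric polynomials may be inserted into the weak form of the scheme.\<close>

lemma trig_poly_test_fun:
  assumes "trig_poly f"
  shows "test_fun f"
proof -
  have "trig_poly (foldr pderivative is f)" for "is"
    using assms by (induction "is") (auto intro: trig_poly_pderivative)
  moreover have "f (x + (2 * pi) *\<^sub>R axis i 1) = f x" for x i
    by (rule trig_poly_translate[OF assms]) (auto simp: axis_def)
  ultimately show ?thesis
    by (simp add: test_fun_def smooth_fun_def torus_periodic_def differentiable_on_def
        trig_poly_differentiable differentiable_at_withinI)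
qed

text \<open>A mode with wave vector k is an eigenfunction of the Laplacian with eigenvalue -|k|^2.
  Its coefficient is divided by 1 + a |k|^2, which is positive since a \<ge> 0; sums follow by
  linearity.\<close>

lemma trig_poly_resolvent:
  assumes "0 \<le> a" "trig_poly f"
  obtains g where "trig_poly g" "\<And>x. g x - a * laplacian g x = f x"
proof -
  have "\<exists>g. trig_poly g \<and> (\<forall>x. g x - a * laplacian g x = f x)"
    using assms(2)
  proof (induction rule: trig_poly.induct)
    case (cos c k)
    let ?q = "\<Sum>i\<in>UNIV. (real_of_int (k $ i))\<^sup>2"
    let ?d = "c / (1 + a * ?q)"
    have "0 \<le> a * ?q" using assms(1) by (simp add: sum_nonneg)
    moreover have "laplacian (\<lambda>x. ?d * cos (phase k x)) x = - ?d * ?q * cos (phase k x)" for x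
      by (simp only: laplacian_def pderivative_cos pderivative_sin sum_distrib_left sum_distrib_right)
        (rule sum.cong, auto simp: power2_eq_square)
    ultimately have "?d * cos (phase k x) - a * laplacian (\<lambda>x. ?d * cos (phase k x)) x
        = c * cos (phase k x)" for x
      by (simp add: field_simps)
    then show ?case using trig_poly.cos by blast
  next
    case (sin c k)
    let ?q = "\<Sum>i\<in>UNIV. (real_of_int (k $ i))\<^sup>2"
    let ?d = "c / (1 + a * ?q)"
    have "0 \<le> a * ?q" using assms(1) by (simp add: sum_nonneg)
    moreover have "laplacian (\<lambda>x. ?d * sin (phase k x)) x = - ?d * ?q * sin (phase k x)" for x
      by (simp only: laplacian_def pderivative_cos pderivative_sin sum_distrib_left sum_distrib_right)
        (rule sum.cong, auto simp: power2_eq_square)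
    ultimately have "?d * sin (phase k x) - a * laplacian (\<lambda>x. ?d * sin (phase k x)) x
        = c * sin (phase k x)" for x
      by (simp add: field_simps)
    then show ?case using trig_poly.sin by blast
  next
    case (add f1 f2)
    then obtain g1 g2 where g: "trig_poly g1" "trig_poly g2"
      "\<forall>x. g1 x - a * laplacian g1 x = f1 x" "\<forall>x. g2 x - a * laplacian g2 x = f2 x"
      by blast
    have "(g1 x + g2 x) - a * laplacian (\<lambda>x. g1 x + g2 x) x = f1 x + f2 x" for x
      using g(3,4)[THEN spec, of x] by (simp add: laplacian_add g(1,2) algebra_simps)
    then show ?case using trig_poly.add[OF g(1,2)] by blast
  qed
  then show ?thesis using that by blast
qed

subsection \<open>Maximum principle for the resolvent of the Laplacian\<close>

text \<open>If l < 0, then f' is negative just to the right of x, because f' vanishes at x itself.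
  The mean value theorem then yields a value of f below the minimum.\<close>

lemma second_derivative_nonneg_at_min:
  fixes f f' :: "real \<Rightarrow> real"
  assumes f: "\<And>t. (f has_real_derivative f' t) (at t)"
    and f': "(f' has_real_derivative l) (at x)"
    and min: "\<And>t. f x \<le> f t"
  shows "0 \<le> l"
proof (rule ccontr)
  assume "\<not> 0 \<le> l"
  then obtain d where d: "d > 0" "\<And>h. 0 < h \<Longrightarrow> h < d \<Longrightarrow> f' (x + h) < f' x"
    using DERIV_neg_dec_right[OF f'] by force
  have "f' x = 0"
    by (rule DERIV_local_min[OF f[of x] zero_less_one]) (use min in auto)
  obtain z where "x < z" "z < x + d / 2" "f (x + d / 2) - f x = d / 2 * f' z"
    using MVT2[of x "x + d / 2" f f'] d(1) f by auto
  moreover from this have "d / 2 * f' z < 0"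
    using d(2)[of "z - x"] \<open>f' x = 0\<close> d(1) by (intro mult_pos_neg) auto
  ultimately show False
    using min[of "x + d / 2"] by linarith
qed

lemma torus_cell_iff: "x \<in> torus_cell \<longleftrightarrow> (\<forall>i. - pi \<le> x $ i \<and> x $ i \<le> pi)"
  by (simp add: torus_cell_def mem_box_cart)

lemma trig_poly_attains_min:
  fixes f :: "real ^ 'd \<Rightarrow> real"
  assumes "trig_poly f"
  obtains x0 where "\<And>x. f x0 \<le> f x"
proof -
  have "(0::real^'d) \<in> torus_cell"
    by (simp add: torus_cell_iff)
  then obtain x0 where x0: "\<And>x. x \<in> torus_cell \<Longrightarrow> f x0 \<le> f x"
    using continuous_attains_inf[of torus_cell f] trig_poly_continuous_on[OF assms]
    by (metis compact_cbox torus_cell_def empty_iff)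
  have "f x0 \<le> f x" for x
  proof -
    \<comment> \<open>Rounding each coordinate, measured in periods, picks the lattice shift that
      carries x into the cell: a rounding error of at most 1/2 becomes at most pi.\<close>
    define m :: "real ^ 'd" where "m = (\<chi> i. - of_int (round (x $ i / (2 * pi))))"
    have "x + (2 * pi) *\<^sub>R m \<in> torus_cell"
      unfolding torus_cell_iff
    proof
      fix i
      have "\<bar>of_int (round (x $ i / (2 * pi))) - x $ i / (2 * pi)\<bar> \<le> 1 / 2"
        by (rule of_int_round_abs_le)
      then have "2 * pi * \<bar>of_int (round (x $ i / (2 * pi))) - x $ i / (2 * pi)\<bar> \<le> 2 * pi * (1 / 2)"
        by (intro mult_left_mono) auto
      then have "\<bar>2 * pi * (of_int (round (x $ i / (2 * pi))) - x $ i / (2 * pi))\<bar> \<le> pi"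
        by (simp add: abs_mult)
      then show "- pi \<le> (x + (2 * pi) *\<^sub>R m) $ i \<and> (x + (2 * pi) *\<^sub>R m) $ i \<le> pi"
        by (auto simp: m_def algebra_simps abs_le_iff)
    qed
    moreover have "f (x + (2 * pi) *\<^sub>R m) = f x"
      by (rule trig_poly_translate[OF assms]) (auto simp: m_def)
    ultimately show ?thesis using x0 by metis
  qed
  then show ?thesis using that by blast
qed

text \<open>At a global minimum x0 every pure second partial is nonnegative, whence f x \<ge> f x0
  \<ge> a * laplacian f x0 \<ge> 0.\<close>

lemma trig_poly_resolvent_nonneg:
  assumes f: "trig_poly f" and "0 \<le> a" and nonneg: "\<And>x. 0 \<le> f x - a * laplacian f x"
  shows "0 \<le> f x"
proof -
  obtain x0 where x0: "\<And>x. f x0 \<le> f x"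
    using trig_poly_attains_min[OF f] by blast
  have "0 \<le> pderivative i (pderivative i f) x0" for i
  proof (rule second_derivative_nonneg_at_min[where x = 0])
    show "((\<lambda>t. f (x0 + t *\<^sub>R axis i 1)) has_real_derivative
        pderivative i f (x0 + t *\<^sub>R axis i 1)) (at t)" for t
      by (rule trig_poly_has_derivative_axis[OF f])
    show "((\<lambda>t. pderivative i f (x0 + t *\<^sub>R axis i 1)) has_real_derivative
        pderivative i (pderivative i f) x0) (at 0)"
      using trig_poly_has_derivative_axis[OF trig_poly_pderivative[OF f], where x = x0 and t = 0] by simp
  qed (use x0 in simp)
  then have "0 \<le> a * laplacian f x0"
    using \<open>0 \<le> a\<close> by (simp add: laplacian_def sum_nonneg)
  with nonneg[of x0] x0[of x] show ?thesis by linarith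
qed

subsection \<open>Integrals over the torus\<close>

text \<open>Lebesgue measure is the image of the product of one-dimensional measures, so Fubini
  separates the coordinates.\<close>

lemma integral_lborel_prod:
  fixes f :: "'a::euclidean_space \<Rightarrow> real \<Rightarrow> 'b::{real_normed_field,banach,second_countable_topology}"
  assumes f: "\<And>b. b \<in> Basis \<Longrightarrow> integrable lborel (f b)"
  shows "(\<integral>x. (\<Prod>b\<in>Basis. f b (x \<bullet> b)) \<partial>lborel) = (\<Prod>b\<in>Basis. integral\<^sup>L lborel (f b))"
proof -
  interpret product_sigma_finite "\<lambda>b::'a. lborel :: real measure" ..
  have [measurable]: "f b \<in> borel_measurable borel" if "b \<in> Basis" for b
    using borel_measurable_integrable[OF f[OF that]] by simp
  have "(\<integral>x. (\<Prod>b\<in>Basis. f b (x \<bullet> b)) \<partial>lborel)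
      = (\<integral>x. (\<Prod>b\<in>Basis. f b (x b)) \<partial>(\<Pi>\<^sub>M b\<in>Basis. lborel))"
    by (subst lborel_eq, subst integral_distr) auto
  also have "\<dots> = (\<Prod>b\<in>Basis. integral\<^sup>L lborel (f b))"
    by (rule product_integral_prod) (auto intro: f)
  finally show ?thesis .
qed

text \<open>The antiderivative cis (n t) / (i n) takes equal values at both endpoints, since they
  are a whole number of periods apart.\<close>

lemma integral_cis_period:
  assumes "n \<in> \<int>" "n \<noteq> 0"
  shows "(\<integral>t. indicator {-pi..pi} t *\<^sub>R cis (n * t) \<partial>lborel) = 0"
proof -
  have "(\<integral>t. indicator {-pi..pi} t *\<^sub>R cis (n * t) \<partial>lborel)
      = cis (n * pi) / (\<i> * of_real n) - cis (n * (-pi)) / (\<i> * of_real n)"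
  proof (rule integral_FTC_atLeastAtMost)
    fix t
    show "((\<lambda>t. cis (n * t) / (\<i> * of_real n)) has_vector_derivative cis (n * t)) (at t within {-pi..pi})"
      using has_vector_derivative_mult_left[OF exp_scaleR_has_vector_derivative_right[of "\<i> * of_real n"],
          of "1 / (\<i> * of_real n)" t "{-pi..pi}"] assms
      by (simp add: cis_conv_exp scaleR_conv_of_real mult_ac)
  qed (auto intro!: continuous_intros)
  also have "cis (n * (-pi)) = cis (n * pi)"
    using assms by (auto elim!: Ints_cases simp: complex_eq_iff sin_zero_iff_int2)
  finally show ?thesis by simp
qed

lemma torus_cell_sets_lebesgue [measurable]: "torus_cell \<in> sets lebesgue"
  by (simp add: torus_cell_def)

lemma finite_measure_torus: "finite_measure torus_measure"
  by (rule finite_measureI)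
    (simp add: emeasure_restrict_space torus_cell_def emeasure_lborel_cbox_eq)

text \<open>Both the exponential and the indicator of the cell are products over coordinates. The
  factor belonging to a nonzero entry of k integrates to 0 and annihilates the product.\<close>

lemma integral_cis_phase:
  fixes k :: "int ^ 'd"
  assumes "k \<noteq> 0"
  shows "(\<integral>x. cis (phase k x) \<partial>torus_measure) = 0"
proof -
  obtain j where j: "k $ j \<noteq> 0"
    using assms by (auto simp: vec_eq_iff)
  define F where "F = (\<lambda>(b::real^'d) t. indicator {-pi..pi} t *\<^sub>R cis (phase k b * t))"
  have phase: "phase k x = (\<Sum>b\<in>Basis. phase k b * (x \<bullet> b))" for x :: "real ^ 'd"
  proof -
    interpret bounded_linear "phase k" by (rule bounded_linear_phase)
    have "phase k x = phase k (\<Sum>b\<in>Basis. (x \<bullet> b) *\<^sub>R b)"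
      by (simp add: euclidean_representation)
    also have "\<dots> = (\<Sum>b\<in>Basis. phase k b * (x \<bullet> b))"
      by (simp add: sum scaleR mult.commute)
    finally show ?thesis .
  qed
  have cell: "indicator torus_cell x = (\<Prod>b\<in>Basis. indicat_real {-pi..pi} (x \<bullet> b))" for x :: "real ^ 'd"
  proof (cases "x \<in> torus_cell")
    case True
    then have "\<forall>b\<in>Basis. x \<bullet> b \<in> {-pi..pi}"
      by (auto simp: torus_cell_iff Basis_vec_def inner_axis)
    with True show ?thesis by (auto simp: prod.neutral)
  next
    case False
    then obtain i where "x \<bullet> axis i 1 \<notin> {-pi..pi}"
      by (auto simp: torus_cell_iff inner_axis)
    moreover have "axis i (1::real) \<in> Basis" by (simp add: axis_in_Basis_iff)
    ultimately show ?thesis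
      using False by (subst prod_zero) (auto intro!: bexI[of _ "axis i 1"])
  qed
  have cis_prod: "cis (\<Sum>b\<in>I. g b) = (\<Prod>b\<in>I. cis (g b))" if "finite I" for I and g :: "real ^ 'd \<Rightarrow> real"
    using that by (induction rule: finite_induct) (auto simp: cis_mult[symmetric])
  have F: "indicator torus_cell x *\<^sub>R cis (phase k x) = (\<Prod>b\<in>Basis. F b (x \<bullet> b))" for x
    unfolding F_def scaleR_conv_of_real prod.distrib cell of_real_prod[symmetric]
    by (subst phase) (simp add: cis_prod)
  have int: "integrable lborel (F b)" for b
    unfolding F_def
    by (rule borel_integrable_compact) (auto intro!: continuous_intros)
  have "(\<integral>x. cis (phase k x) \<partial>torus_measure) = (\<integral>x. indicator torus_cell x *\<^sub>R cis (phase k x) \<partial>lebesgue)"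
    by (rule integral_restrict_space) simp
  \<comment> \<open>The product formula lives on \<open>lborel\<close>; completing the measure does
    not change the integral of a Borel function.\<close>
  also have "\<dots> = (\<integral>x. indicator torus_cell x *\<^sub>R cis (phase k x) \<partial>lborel)"
  proof (rule integral_completion)
    have "continuous_on UNIV (\<lambda>x. cis (phase k x))"
      by (intro continuous_intros linear_continuous_on bounded_linear_phase)
    then have "(\<lambda>x. cis (phase k x)) \<in> borel_measurable borel"
      by (rule borel_measurable_continuous_onI)
    then show "(\<lambda>x. indicator torus_cell x *\<^sub>R cis (phase k x)) \<in> borel_measurable lborel"
      by (auto simp: torus_cell_def)
  qed
  also have "\<dots> = (\<Prod>b\<in>Basis. integral\<^sup>L lborel (F b))"
    unfolding F by (rule integral_lborel_prod) (rule int)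
  also have "\<dots> = 0"
  proof (rule prod_zero)
    show "\<exists>b\<in>Basis. integral\<^sup>L lborel (F b) = 0"
    proof
      show "axis j (1::real) \<in> Basis" by (simp add: axis_in_Basis_iff)
      show "integral\<^sup>L lborel (F (axis j 1)) = 0"
        unfolding F_def by (rule integral_cis_period) (use j in \<open>auto simp: phase_axis\<close>)
    qed
  qed simp
  finally show ?thesis .
qed

section \<open>Integrability against trigonometric polynomials, and vanishing integrals of
  derivatives\<close>

lemma trig_poly_bounded:
  assumes "trig_poly f"
  obtains B where "\<And>x. \<bar>f x\<bar> \<le> B"
proof -
  have "\<exists>B. \<forall>x. \<bar>f x\<bar> \<le> B"
    using assms
  proof (induction rule: trig_poly.induct)
    case (cos c k)
    show ?case by (rule exI[of _ "\<bar>c\<bar>"]) (simp add: abs_mult mult_left_le)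
  next
    case (sin c k)
    show ?case by (rule exI[of _ "\<bar>c\<bar>"]) (simp add: abs_mult mult_left_le)
  next
    case (add f g)
    then show ?case by (meson abs_triangle_ineq add_mono order_trans)
  qed
  then show ?thesis using that by blast
qed

lemma trig_poly_measurable:
  assumes "trig_poly f"
  shows "f \<in> borel_measurable torus_measure"
  by (intro measurable_restrict_space1 measurable_completion)
    (simp add: borel_measurable_continuous_onI trig_poly_continuous_on assms)

lemma integrable_mult_trig_poly:
  assumes f: "trig_poly f" and w: "integrable torus_measure w"
  shows "integrable torus_measure (\<lambda>x. w x * f x)"
proof -
  obtain B where B: "\<And>x. \<bar>f x\<bar> \<le> B"
    using trig_poly_bounded[OF f] by blast
  show ?thesis
  proof (rule Bochner_Integration.integrable_bound[of _ "\<lambda>x. B * w x"])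
    show "(\<lambda>x. w x * f x) \<in> borel_measurable torus_measure"
      using trig_poly_measurable[OF f] w by measurable
    show "AE x in torus_measure. norm (w x * f x) \<le> norm (B * w x)"
    proof (intro AE_I2)
      fix x
      have "\<bar>f x\<bar> * \<bar>w x\<bar> \<le> \<bar>B\<bar> * \<bar>w x\<bar>"
        by (rule mult_right_mono[OF order_trans[OF B abs_ge_self] abs_ge_zero])
      then show "norm (w x * f x) \<le> norm (B * w x)"
        by (simp add: abs_mult mult.commute)
    qed
  qed (use w in simp)
qed

lemma integrable_const_torus: "integrable torus_measure (\<lambda>x. c :: real)"
  using finite_measure.integrable_const[OF finite_measure_torus] .

lemma integrable_trig_poly: "trig_poly f \<Longrightarrow> integrable torus_measure f"
  using integrable_mult_trig_poly[OF _ integrable_const_torus[of 1]] by simp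

lemma integral_cis_phase_Re_Im:
  assumes "k \<noteq> 0"
  shows "(\<integral>x. cos (phase k x) \<partial>torus_measure) = 0"
    and "(\<integral>x. sin (phase k x) \<partial>torus_measure) = 0"
proof -
  have cis_eq: "cis t = of_real (cos t) + \<i> * of_real (sin t)" for t
    by (simp add: complex_eq_iff)
  have int: "integrable torus_measure (\<lambda>x. cis (phase k x))"
    using integrable_trig_poly[OF trig_poly.cos[of 1 k]] integrable_trig_poly[OF trig_poly.sin[of 1 k]]
    by (simp add: cis_eq)
  show "(\<integral>x. cos (phase k x) \<partial>torus_measure) = 0"
    using integral_Re[OF int] integral_cis_phase[OF assms] by simp
  show "(\<integral>x. sin (phase k x) \<partial>torus_measure) = 0"
    using integral_Im[OF int] integral_cis_phase[OF assms] by simp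
qed

text \<open>Differentiating a mode produces another mode of the same wave vector k: for k = 0 its
  coefficient vanishes, otherwise its integral does.\<close>

lemma integral_pderivative:
  assumes "trig_poly f"
  shows "(\<integral>x. pderivative i f x \<partial>torus_measure) = 0"
  using assms
proof (induction rule: trig_poly.induct)
  case (cos c k)
  have "(\<integral>x. sin (phase k x) \<partial>torus_measure) = 0" if "k \<noteq> 0"
    using integral_cis_phase_Re_Im(2)[OF that] .
  then show ?case
    by (cases "k = 0") (auto simp: pderivative_cos)
next
  case (sin c k)
  have "(\<integral>x. cos (phase k x) \<partial>torus_measure) = 0" if "k \<noteq> 0"
    using integral_cis_phase_Re_Im(1)[OF that] .
  then show ?case
    by (cases "k = 0") (auto simp: pderivative_sin)
next
  case (add f g)
  then show ?case
    by (simp add: pderivative_add integrable_trig_poly trig_poly_pderivative)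
qed

lemma integral_laplacian:
  assumes "trig_poly f"
  shows "(\<integral>x. laplacian f x \<partial>torus_measure) = 0"
  unfolding laplacian_def
  by (simp add: integrable_trig_poly trig_poly_pderivative integral_pderivative assms)

subsection \<open>Testing nonnegativity by trigonometric polynomials\<close>

text \<open>The torus as a product of unit circles. Opposite faces of the cell are glued, and
  polynomials on the target pull back to trigonometric polynomials, which makes Stone-Weierstrass
  available.\<close>

definition torus_emb :: "real ^ 'd \<Rightarrow> (real ^ 'd) \<times> (real ^ 'd)" where
  "torus_emb x = (\<chi> i. cos (x $ i), \<chi> i. sin (x $ i))"

lemma trig_poly_real_polynomial_torus_emb:
  assumes "real_polynomial_function p"
  shows "trig_poly (\<lambda>x. p (torus_emb x))"
  using assms
proof (induction rule: real_polynomial_function.induct)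
  case (linear f)
  interpret bounded_linear f by (rule linear)
  have coord: "trig_poly (\<lambda>x. torus_emb x \<bullet> b)" if "b \<in> Basis" for b :: "(real ^ 'd) \<times> (real ^ 'd)"
    using that trig_poly.cos[of 1 "axis i 1" for i] trig_poly.sin[of 1 "axis i 1" for i]
    by (auto simp: Basis_prod_def Basis_vec_def torus_emb_def inner_axis phase_axis_left)
  have "f (torus_emb x) = (\<Sum>b\<in>Basis. f b * (torus_emb x \<bullet> b))" for x
    by (subst euclidean_representation[of "torus_emb x", symmetric])
      (simp only: sum scaleR real_scaleR_def mult.commute)
  then show ?case
    by (simp only:) (intro trig_poly_sum trig_poly_cmult coord finite_Basis)
qed (auto intro: trig_poly_const trig_poly.add trig_poly_mult)

lemma continuous_on_torus_emb: "continuous_on S torus_emb"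
  unfolding torus_emb_def by (intro continuous_intros)

text \<open>Equal images force coordinates to differ by multiples of 2 pi. One point lies in the
  open box because two points of the closed cell on opposite faces would have the same image; with
  one interior point the difference is strictly below 2 pi.\<close>

lemma torus_emb_eq_imp_eq:
  assumes "x \<in> torus_cell" and y: "y \<in> box (\<chi> i. - pi) (\<chi> i. pi)" and eq: "torus_emb x = torus_emb y"
  shows "x = y"
proof (rule vec_eq_iff[THEN iffD2], rule allI)
  fix i
  have "cos (x $ i) = cos (y $ i)" "sin (x $ i) = sin (y $ i)"
    using eq by (auto simp: torus_emb_def vec_eq_iff)
  then obtain n :: int where n: "x $ i = y $ i + 2 * pi * n"
    using sin_cos_eq_iff by metis
  have "\<bar>x $ i - y $ i\<bar> < 2 * pi"
    using assms(1) y by (auto simp: torus_cell_iff mem_box_cart abs_less_iff)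
      (smt (verit))+
  then have "2 * pi * \<bar>n\<bar> < 2 * pi * 1"
    using n by (simp add: abs_mult)
  then have "real_of_int \<bar>n\<bar> < 1"
    by (subst (asm) mult_less_cancel_left_pos) auto
  then have "n = 0" by linarith
  with n show "x $ i = y $ i" by simp
qed

text \<open>On the image of the torus, the indicator of the compact image of K is the limit of
  continuous cutoffs of the distance to it. Stone-Weierstrass replaces each cutoff by a polynomial
  with error below 1/(n+1), which is then pulled back.\<close>

lemma trig_poly_approx_indicator:
  fixes K :: "(real ^ 'd) set"
  assumes K: "compact K" "K \<subseteq> box (\<chi> i. - pi) (\<chi> i. pi)" "K \<noteq> {}"
  obtains p where "\<And>n::nat. trig_poly (p n)" "\<And>n x. 0 \<le> p n x" "\<And>n x. p n x \<le> 3"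
    "\<And>x. x \<in> torus_cell \<Longrightarrow> (\<lambda>n. p n x) \<longlonglongrightarrow> indicator K x"
proof -
  define K' where "K' = torus_emb ` K"
  have K': "closed K'" "K' \<noteq> {}"
    using compact_continuous_image[OF continuous_on_torus_emb K(1)] K(3)
    by (auto simp: K'_def compact_imp_closed)
  \<comment> \<open>A cutoff equal to 1 on \<open>K'\<close> and, for n > 0, equal to 0 at distance
    1/n or more.\<close>
  define F where "F = (\<lambda>n z. max 0 (1 - real n * infdist z K'))"
  have F01: "0 \<le> F n z" "F n z \<le> 1" for n z
    by (auto simp: F_def infdist_nonneg)
  let ?S = "cbox (\<chi> i. -1, \<chi> i. -1) (\<chi> i. 1, \<chi> i. 1) :: ((real ^ 'd) \<times> (real ^ 'd)) set"
  have "\<exists>P. real_polynomial_function P \<and> (\<forall>z\<in>?S. \<bar>F n z - P z\<bar> < 1 / real (Suc n))" for n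
  proof -
    have "continuous_on ?S (F n)"
      unfolding F_def by (intro continuous_intros)
    from Stone_Weierstrass_real_polynomial_function[OF compact_cbox this, of "1 / real (Suc n)"]
    show ?thesis by (metis of_nat_0_less_iff zero_less_Suc zero_less_divide_1_iff)
  qed
  then obtain P where P: "\<And>n. real_polynomial_function (P n)"
    "\<And>n z. z \<in> ?S \<Longrightarrow> \<bar>F n z - P n z\<bar> < 1 / real (Suc n)"
    by metis
  have S: "torus_emb x \<in> ?S" for x :: "real ^ 'd"
    by (simp add: cbox_Pair_eq mem_box_cart torus_emb_def)
  \<comment> \<open>the approximation error is added back to keep the polynomial nonnegative\<close>
  define p where "p = (\<lambda>n x. P n (torus_emb x) + 1 / real (Suc n))"
  have p: "\<bar>p n x - (F n (torus_emb x) + 1 / real (Suc n))\<bar> < 1 / real (Suc n)" for n x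
    using P(2)[OF S, of n x] by (simp add: p_def abs_minus_commute)
  show ?thesis
  proof
    show "trig_poly (p n)" for n
      unfolding p_def
      by (intro trig_poly.add trig_poly_const trig_poly_real_polynomial_torus_emb P(1))
    show "0 \<le> p n x" for n x
      using p[of n x] F01[of n "torus_emb x"] by linarith
    \<comment> \<open>The bound 3 is 1 for the cutoff, 1 for the added constant and 1 for the
      approximation error.\<close>
    have "1 / real (Suc n) \<le> 1" for n by simp
    then show "p n x \<le> 3" for n x
      using p[of n x] F01[of n "torus_emb x"] by (smt (verit))
    show "(\<lambda>n. p n x) \<longlonglongrightarrow> indicator K x" if x: "x \<in> torus_cell" for x
    proof -
      have "(\<lambda>n. F n (torus_emb x)) \<longlonglongrightarrow> indicator K x"
      proof (cases "x \<in> K")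
        case True
        then show ?thesis by (simp add: F_def K'_def)
      next
        case False
        then have "torus_emb x \<notin> K'"
          using torus_emb_eq_imp_eq[OF x] K(2) by (auto simp: K'_def)
        then have pos: "0 < infdist (torus_emb x) K'"
          using infdist_pos_not_in_closed[OF K'] by blast
        obtain N :: nat where "1 / infdist (torus_emb x) K' < N"
          using reals_Archimedean2 by blast
        then have N: "1 < N * infdist (torus_emb x) K'"
          using pos by (simp add: field_simps)
        have "F n (torus_emb x) = 0" if "n \<ge> N" for n
        proof -
          have "real N * infdist (torus_emb x) K' \<le> real n * infdist (torus_emb x) K'"
            using that pos by (intro mult_right_mono) auto
          with N show ?thesis by (simp add: F_def)
        qed
        then have "\<forall>\<^sub>F n in sequentially. F n (torus_emb x) = 0"
          by (auto simp: eventually_sequentially)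
        with False show ?thesis by (simp add: tendsto_eventually)
      qed
      moreover have "(\<lambda>n. p n x - F n (torus_emb x)) \<longlonglongrightarrow> 0"
      proof (rule Lim_null_comparison)
        have "norm (p n x - F n (torus_emb x)) \<le> 2 * (1 / real (Suc n))" for n
          using p[of n x] by simp
        then show "\<forall>\<^sub>F n in sequentially. norm (p n x - F n (torus_emb x)) \<le> 2 * (1 / real (Suc n))"
          by simp
        show "(\<lambda>n. 2 * (1 / real (Suc n))) \<longlonglongrightarrow> 0"
          using tendsto_mult[OF tendsto_const[of 2] LIMSEQ_inverse_real_of_nat]
          by (simp add: inverse_eq_divide)
      qed
      ultimately show ?thesis
        using tendsto_add by fastforce
    qed
  qed
qed

text \<open>On a compact set K where w < 0, approximating the indicator of K gives a nonnegative
  integral of w over K, so K is null. Up to a null set, the region where w < 0 is a countable union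
  of such K.\<close>

lemma AE_nonneg_if_trig_poly_nonneg:
  fixes w :: "real ^ 'd \<Rightarrow> real"
  assumes w: "integrable torus_measure w"
    and nonneg: "\<And>\<psi>. trig_poly \<psi> \<Longrightarrow> (\<And>x. 0 \<le> \<psi> x) \<Longrightarrow> 0 \<le> (\<integral>x. w x * \<psi> x \<partial>torus_measure)"
  shows "AE x in torus_measure. 0 \<le> w x"
proof -
  let ?B = "box (\<chi> i. - pi) (\<chi> i. pi) :: (real ^ 'd) set"
  have BC: "?B \<subseteq> torus_cell"
    unfolding torus_cell_def by (rule box_subset_cbox)
  have compact_null: "negligible K"
    if K: "compact K" "K \<subseteq> ?B" "\<And>x. x \<in> K \<Longrightarrow> w x < 0" for K
  proof (cases "K = {}")
    case False
    from trig_poly_approx_indicator[OF K(1,2) False] obtain p where p: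
      "\<And>n::nat. trig_poly (p n)" "\<And>n x. 0 \<le> p n x" "\<And>n x. p n x \<le> 3"
      "\<And>x. x \<in> torus_cell \<Longrightarrow> (\<lambda>n. p n x) \<longlonglongrightarrow> indicator K x"
      by blast
    have Kmeas: "K \<in> sets torus_measure"
      using K(1,2) BC by (auto simp: sets_restrict_space_iff compact_imp_closed)
    then have wK: "integrable torus_measure (\<lambda>x. w x * indicator K x)"
      using integrable_mult_indicator[OF _ w] by (simp add: mult.commute)
    \<comment> \<open>Passage to the limit by dominated convergence; the uniform bound on
      \<open>p n\<close> supplies the majorant 3 |w|.\<close>
    have "(\<lambda>n. \<integral>x. w x * p n x \<partial>torus_measure) \<longlonglongrightarrow> (\<integral>x. w x * indicator K x \<partial>torus_measure)"
    proof (rule integral_dominated_convergence[where w = "\<lambda>x. 3 * \<bar>w x\<bar>"])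
      show "(\<lambda>x. w x * indicator K x) \<in> borel_measurable torus_measure"
        using wK by simp
      show "(\<lambda>x. w x * p n x) \<in> borel_measurable torus_measure" for n
        using integrable_mult_trig_poly[OF p(1) w] by simp
      show "AE x in torus_measure. (\<lambda>n. w x * p n x) \<longlonglongrightarrow> w x * indicator K x"
        by (intro AE_I2 tendsto_mult tendsto_const) (simp add: p(4))
      show "AE x in torus_measure. norm (w x * p n x) \<le> 3 * \<bar>w x\<bar>" for n
        using mult_right_mono[OF p(3) abs_ge_zero, of n _ "w _"] p(2)
        by (auto simp: abs_mult mult.commute)
    qed (use w in auto)
    then have "0 \<le> (\<integral>x. w x * indicator K x \<partial>torus_measure)"
      by (rule LIMSEQ_le_const) (use nonneg p(1,2) in auto)
    moreover have "0 \<le> (\<integral>x. - (w x * indicator K x) \<partial>torus_measure)"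
      using K(3) by (intro Bochner_Integration.integral_nonneg) (auto simp: indicator_def less_imp_le)
    ultimately have "(\<integral>x. - (w x * indicator K x) \<partial>torus_measure) = 0"
      by simp
    then have "AE x in torus_measure. - (w x * indicator K x) = 0"
      by (subst (asm) integral_nonneg_eq_0_iff_AE)
        (use wK K(3) in \<open>auto simp: indicator_def less_imp_le\<close>)
    then have "AE x in torus_measure. x \<notin> K"
      by eventually_elim (use K(3) in \<open>force simp: indicator_def\<close>)
    then have "AE x in lebesgue. x \<notin> K"
      using K(2) BC by (subst (asm) AE_restrict_space_iff) auto
    then show ?thesis
      using K(1) by (simp add: negligible_iff_null_sets AE_iff_null_sets compact_imp_closed)
  qed simp
  \<comment> \<open>Only the open box is considered, since indicators are approximated for compact
    sets inside it; the boundary of the cell is null and is added at the end.\<close>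
  define N where "N = {x \<in> ?B. w x < 0}"
  have N: "N \<in> sets lebesgue"
  proof -
    have "{x \<in> space torus_measure. w x < 0} \<in> sets torus_measure"
      using borel_measurable_integrable[OF w] by measurable
    then have "{x \<in> torus_cell. w x < 0} \<in> sets lebesgue"
      by (simp add: sets_restrict_space_iff)
    moreover have "N = {x \<in> torus_cell. w x < 0} \<inter> ?B"
      using BC by (auto simp: N_def)
    ultimately show ?thesis by auto
  qed
  have "negligible N"
  proof -
    obtain C Z where CZ: "fsigma C" "Z \<in> null_sets lebesgue" "C \<union> Z = N"
      using lebesgue_set_almost_fsigma[OF N] by metis
    then obtain F :: "nat \<Rightarrow> (real ^ 'd) set" where F: "range F \<subseteq> Collect compact" "C = \<Union>(range F)"
      by (metis fsigma_Union_compact)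
    have "negligible C"
      unfolding F(2)
    proof (rule negligible_countable_Union)
      fix S assume "S \<in> range F"
      then have "compact S" "S \<subseteq> N"
        using F CZ(3) by auto
      then show "negligible S"
        by (intro compact_null) (auto simp: N_def)
    qed auto
    then show ?thesis
      using CZ(2,3) negligible_Un negligible_iff_null_sets by blast
  qed
  moreover have "negligible (torus_cell - ?B)"
    unfolding torus_cell_def by (rule negligible_frontier_interval)
  ultimately have "negligible (N \<union> (torus_cell - ?B))"
    by (rule negligible_Un)
  then have "AE x in lebesgue. x \<notin> N \<union> (torus_cell - ?B)"
    unfolding negligible_iff_null_sets by (rule AE_not_in)
  then have "AE x in lebesgue. x \<in> torus_cell \<longrightarrow> 0 \<le> w x"
    by eventually_elim (auto simp: N_def)
  then show ?thesis
    by (subst AE_restrict_space_iff) auto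
qed

subsection \<open>One step of the scheme\<close>

text \<open>The cubic is odd and has a critical point at M, so its gap to the value 2 M^3 has the
  double factor (M - t)^2; the remaining factor 2 M + t is nonnegative on the interval. Oddness
  gives the other sign.\<close>

lemma cubic_increasing_bound:
  fixes M s :: real
  assumes "\<bar>s\<bar> \<le> M"
  shows "\<bar>3 * M\<^sup>2 * s - s ^ 3\<bar> \<le> 2 * M ^ 3"
proof -
  have "3 * M\<^sup>2 * t - t ^ 3 \<le> 2 * M ^ 3" if "\<bar>t\<bar> \<le> M" for t
  proof -
    have "2 * M ^ 3 - (3 * M\<^sup>2 * t - t ^ 3) = (M - t)\<^sup>2 * (2 * M + t)"
      by algebra
    moreover have "0 \<le> (M - t)\<^sup>2 * (2 * M + t)"
      using that by (intro mult_nonneg_nonneg) auto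
    ultimately show ?thesis by linarith
  qed
  from this[of s] this[of "- s"] assms show ?thesis by (simp add: abs_le_iff)
qed

text \<open>This cubic need not be monotone: its slope at 0 is 1 - 3 \<kappa> M^2. Instead M - t is
  split off its gap to the value at M, and the quadratic cofactor is smallest at t = - M / 2, where
  it equals 1 - 9/4 \<kappa> M^2. Oddness gives the other sign.\<close>

lemma cubic_remainder_bound:
  fixes M s \<kappa> :: real
  assumes s: "\<bar>s\<bar> \<le> M" and \<kappa>: "0 \<le> \<kappa>" "\<kappa> * (9 / 4 * M\<^sup>2) \<le> 1"
  shows "\<bar>s - \<kappa> * (3 * M\<^sup>2 * s - s ^ 3)\<bar> \<le> M - \<kappa> * (2 * M ^ 3)"
proof -
  have "t - \<kappa> * (3 * M\<^sup>2 * t - t ^ 3) \<le> M - \<kappa> * (2 * M ^ 3)" if "\<bar>t\<bar> \<le> M" for t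
  proof -
    have "M - \<kappa> * (2 * M ^ 3) - (t - \<kappa> * (3 * M\<^sup>2 * t - t ^ 3))
        = (M - t) * ((1 - \<kappa> * (9 / 4 * M\<^sup>2)) + \<kappa> * (t + M / 2)\<^sup>2)"
      by (simp add: field_simps power2_eq_square power3_eq_cube)
    moreover have "0 \<le> (M - t) * ((1 - \<kappa> * (9 / 4 * M\<^sup>2)) + \<kappa> * (t + M / 2)\<^sup>2)"
      using that \<kappa> by (intro mult_nonneg_nonneg add_nonneg_nonneg) auto
    ultimately show ?thesis by linarith
  qed
  from this[of s] this[of "- s"] s show ?thesis by (simp add: abs_le_iff algebra_simps)
qed

text \<open>a and b are the roots of z^2 - A \<tau> z + \<nu> \<tau>, with b the larger one. The
  lower bound on b is the condition on \<kappa> = \<tau> / b required by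
  \<open>cubic_remainder_bound\<close> when 3 M^2 = A + 1.\<close>

lemma elliptic_factorization:
  fixes A \<nu> \<tau> :: real
  assumes "\<nu> > 0" "\<tau> > 0" and A: "A \<ge> 1 + 2 * sqrt (1 + 4 / 3 * (\<nu> / \<tau>))"
  obtains a b where "0 \<le> a" "0 < b" "a + b = A * \<tau>" "a * b = \<nu> * \<tau>" "3 / 4 * (\<tau> * (A + 1)) \<le> b"
proof -
  define q where "q = \<nu> / \<tau>"
  have q: "0 < q" "\<nu> = q * \<tau>" using assms by (auto simp: q_def)
  have A': "A \<ge> 1 + 2 * sqrt (1 + 4 / 3 * q)" using A by (simp only: q_def)
  have "1 \<le> sqrt (1 + 4 / 3 * q)" using q by simp
  with A' have A3: "A \<ge> 3" by linarith
  have "(2 * sqrt (1 + 4 / 3 * q))\<^sup>2 \<le> (A - 1)\<^sup>2"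
    by (rule power_mono) (use A' q in auto)
  then have crit: "4 * (1 + 4 / 3 * q) \<le> (A - 1)\<^sup>2"
    using q by (simp add: power_mult_distrib)
  define D where "D = A\<^sup>2 - 4 * q"
  \<comment> \<open>Multiplying out, this is equivalent to \<open>crit\<close>. The value (A + 3) /
    2 is the one for which A + sqrt D reaches 3/2 (A + 1).\<close>
  have D: "((A + 3) / 2)\<^sup>2 \<le> D"
    using crit by (simp add: D_def power2_eq_square field_simps)
  then have "0 \<le> D" by (rule order_trans[OF zero_le_power2])
  have D_lower: "(A + 3) / 2 \<le> sqrt D"
    using D by (rule real_le_rsqrt)
  have D_upper: "sqrt D \<le> A"
    by (rule real_le_lsqrt) (use A3 q in \<open>auto simp: D_def\<close>)
  show ?thesis
  proof
    show "0 \<le> \<tau> * (A - sqrt D) / 2"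
      using D_upper assms by simp
    show "0 < \<tau> * (A + sqrt D) / 2"
      using D_lower A3 assms by simp
    show "\<tau> * (A - sqrt D) / 2 + \<tau> * (A + sqrt D) / 2 = A * \<tau>"
      by (simp add: field_simps)
    have "\<tau> * (A - sqrt D) / 2 * (\<tau> * (A + sqrt D) / 2) = \<tau>\<^sup>2 * (A\<^sup>2 - (sqrt D)\<^sup>2) / 4"
      by (simp add: field_simps power2_eq_square)
    also have "\<dots> = \<nu> * \<tau>"
      using \<open>0 \<le> D\<close> by (simp add: q(2) D_def power2_eq_square)
    finally show "\<tau> * (A - sqrt D) / 2 * (\<tau> * (A + sqrt D) / 2) = \<nu> * \<tau>" .
    have "\<tau> * (A + (A + 3) / 2) \<le> \<tau> * (A + sqrt D)"
      using D_lower assms by (intro mult_left_mono) auto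
    then show "3 / 4 * (\<tau> * (A + 1)) \<le> \<tau> * (A + sqrt D) / 2"
      by (simp add: field_simps)
  qed
qed

text \<open>The weak form with test function \<phi> pairs v with (1 - a \<Delta>)(1 - b \<Delta>)
  \<phi> = \<psi>. On the right the nonlinear part is paired with -\<tau> \<Delta> \<phi> = (\<tau>
  / b)(\<eta> - \<phi>), which leaves no derivatives and splits the data between \<phi> and
  \<eta>.\<close>

lemma scheme_step_factored:
  fixes u v :: "real ^ 'd \<Rightarrow> real"
  assumes step: "scheme_step \<nu> \<tau> A u v" and \<tau>: "\<tau> \<noteq> 0" and b: "b \<noteq> 0"
    and ab: "a + b = A * \<tau>" "a * b = \<nu> * \<tau>"
    and u: "integrable torus_measure u" "integrable torus_measure (\<lambda>x. nonlin (u x))"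
    and \<phi>: "trig_poly \<phi>"
    and \<eta>: "\<And>x. \<phi> x - b * laplacian \<phi> x = \<eta> x"
    and \<psi>: "\<And>x. \<eta> x - a * laplacian \<eta> x = \<psi> x"
  shows "(\<integral>x. v x * \<psi> x \<partial>torus_measure)
    = (\<integral>x. (u x - \<tau> / b * (A * u x - nonlin (u x))) * \<phi> x \<partial>torus_measure)
      + \<tau> / b * (\<integral>x. (A * u x - nonlin (u x)) * \<eta> x \<partial>torus_measure)"
proof -
  let ?I = "\<lambda>w f. \<integral>x. w x * f x \<partial>torus_measure"
  let ?f = "\<lambda>x. nonlin (u x)"
  define L where "L = laplacian \<phi>"
  define LL where "LL = laplacian L"
  have L: "trig_poly L" "trig_poly LL"
    by (simp_all add: L_def LL_def trig_poly_laplacian \<phi>)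
  have \<eta>': "\<eta> = (\<lambda>x. \<phi> x + (- b) * L x)"
    by (rule ext) (simp add: L_def \<eta>[symmetric])
  have "laplacian \<eta> = (\<lambda>x. L x + (- b) * LL x)"
    unfolding \<eta>' by (simp only: laplacian_add laplacian_cmult \<phi> L trig_poly_cmult)
      (simp only: L_def LL_def)
  then have "\<psi> x = \<eta> x - a * (L x + (- b) * LL x)" for x
    by (simp only: \<psi>[symmetric])
  then have \<psi>': "\<psi> = (\<lambda>x. \<phi> x - (a + b) * L x + (a * b) * LL x)"
    by (simp add: \<eta>' fun_eq_iff algebra_simps)
  have v: "integrable torus_measure v"
    using step by (simp add: scheme_step_def)
  note int = integrable_mult_trig_poly[OF _ v] integrable_mult_trig_poly[OF _ u(1)]
    integrable_mult_trig_poly[OF _ u(2)]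
  have scheme: "(?I v \<phi> - ?I u \<phi>) / \<tau> = - \<nu> * ?I v LL + A * (?I v L - ?I u L) + ?I ?f L"
    using step trig_poly_test_fun[OF \<phi>]
    by (simp add: scheme_step_def dist_of_def dist_laplacian_def L_def LL_def)
  have "?I v \<psi> = (\<integral>x. v x * \<phi> x - (a + b) * (v x * L x) + (a * b) * (v x * LL x) \<partial>torus_measure)"
    by (simp add: \<psi>' algebra_simps)
  also have "\<dots> = ?I v \<phi> - (a + b) * ?I v L + (a * b) * ?I v LL"
    by (simp add: int \<phi> L)
  \<comment> \<open>With a + b = A \<tau> and a b = \<nu> \<tau>, the terms in v are those of the
    scheme multiplied by \<tau>.\<close>
  also have "\<dots> = ?I u \<phi> - \<tau> * (A * ?I u L - ?I ?f L)"
    using scheme \<tau> unfolding ab by (simp add: field_simps)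
  finally have lhs: "?I v \<psi> = ?I u \<phi> - \<tau> * (A * ?I u L - ?I ?f L)" .
  have G: "(\<integral>x. (A * u x - ?f x) * f x \<partial>torus_measure) = A * ?I u f - ?I ?f f" if "trig_poly f" for f
  proof -
    have "(\<integral>x. (A * u x - ?f x) * f x \<partial>torus_measure) = (\<integral>x. A * (u x * f x) - ?f x * f x \<partial>torus_measure)"
      by (simp add: algebra_simps)
    then show ?thesis by (simp add: int that)
  qed
  have \<eta>_trig: "trig_poly \<eta>"
    unfolding \<eta>' by (intro trig_poly.add trig_poly_cmult \<phi> L)
  have I\<eta>: "?I w \<eta> = ?I w \<phi> - b * ?I w L" if "integrable torus_measure w" for w
  proof -
    have "?I w \<eta> = (\<integral>x. w x * \<phi> x - b * (w x * L x) \<partial>torus_measure)"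
      by (simp add: \<eta>' algebra_simps)
    then show ?thesis by (simp add: integrable_mult_trig_poly that \<phi> L)
  qed
  have "(\<integral>x. (u x - \<tau> / b * (A * u x - ?f x)) * \<phi> x \<partial>torus_measure)
      = (\<integral>x. u x * \<phi> x - \<tau> / b * (A * (u x * \<phi> x) - ?f x * \<phi> x) \<partial>torus_measure)"
    by (simp add: algebra_simps)
  also have "\<dots> = ?I u \<phi> - \<tau> / b * (A * ?I u \<phi> - ?I ?f \<phi>)"
    by (simp add: int \<phi>)
  finally show ?thesis
    unfolding lhs G[OF \<eta>_trig] I\<eta>[OF u(1)] I\<eta>[OF u(2)] using b by (simp add: field_simps)
qed

section \<open>Duality estimates and the maximum principle for one step\<close>

lemma abs_integral_mult_le:
  assumes w: "w \<in> borel_measurable torus_measure" "AE x in torus_measure. \<bar>w x\<bar> \<le> C"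
    and f: "trig_poly f" "\<And>x. 0 \<le> f x"
  shows "\<bar>\<integral>x. w x * f x \<partial>torus_measure\<bar> \<le> C * (\<integral>x. f x \<partial>torus_measure)"
proof -
  have "integrable torus_measure w"
    by (rule finite_measure.integrable_const_bound[OF finite_measure_torus _ w(1)]) (use w(2) in simp)
  then have int: "integrable torus_measure (\<lambda>x. w x * f x)"
    by (rule integrable_mult_trig_poly[OF f(1)])
  have "\<bar>\<integral>x. w x * f x \<partial>torus_measure\<bar> \<le> (\<integral>x. \<bar>w x * f x\<bar> \<partial>torus_measure)"
    by (rule integral_abs_bound)
  also have "\<dots> \<le> (\<integral>x. C * f x \<partial>torus_measure)"
  proof (rule integral_mono_AE)
    show "AE x in torus_measure. \<bar>w x * f x\<bar> \<le> C * f x"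
      using w(2) by eventually_elim (simp add: abs_mult f(2) mult_right_mono)
  qed (use int integrable_trig_poly[OF f(1)] in auto)
  finally show ?thesis by simp
qed

text \<open>The Laplacian integrates to 0, so solving the resolvent equation preserves mass. This is
  the dual form of resolvents fixing constants.\<close>

lemma integral_resolvent:
  assumes "trig_poly f" "\<And>x. f x - a * laplacian f x = g x"
  shows "(\<integral>x. g x \<partial>torus_measure) = (\<integral>x. f x \<partial>torus_measure)"
proof -
  have "(\<integral>x. g x \<partial>torus_measure) = (\<integral>x. f x - a * laplacian f x \<partial>torus_measure)"
    by (simp add: assms(2))
  then show ?thesis
    by (simp add: integrable_trig_poly trig_poly_laplacian integral_laplacian assms(1))
qed

lemma scheme_step_max_principle:
  fixes u v :: "real ^ 'd \<Rightarrow> real"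
  assumes nu: "\<nu> > 0" and tau: "\<tau> > 0"
    and A: "A \<ge> 1 + 2 * sqrt (1 + 4 / 3 * (\<nu> / \<tau>))"
    and M: "M = sqrt ((A + 1) / 3)"
    and u: "u \<in> borel_measurable torus_measure" "AE x in torus_measure. \<bar>u x\<bar> \<le> M"
    and step: "scheme_step \<nu> \<tau> A u v"
  shows "AE x in torus_measure. \<bar>v x\<bar> \<le> M"
proof -
  obtain a b where ab: "0 \<le> a" "0 < b" "a + b = A * \<tau>" "a * b = \<nu> * \<tau>"
    and b_large: "3 / 4 * (\<tau> * (A + 1)) \<le> b"
    using elliptic_factorization[OF nu tau A] by blast
  define \<kappa> where "\<kappa> = \<tau> / b"
  define g where "g = (\<lambda>s. A * s - nonlin s)"
  have "0 \<le> sqrt (1 + 4 / 3 * (\<nu> / \<tau>))" using nu tau by simp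
  with A have "0 \<le> A + 1" by linarith
  \<comment> \<open>This turns A s - f(s) = (A + 1) s - s^3 into 3 M^2 s - s^3, so M is exactly the
    positive critical point of g.\<close>
  then have M2: "3 * M\<^sup>2 = A + 1" by (simp add: M)
  have g: "g s = 3 * M\<^sup>2 * s - s ^ 3" for s
    unfolding g_def M2 nonlin_def by (simp add: algebra_simps)
  have \<kappa>: "0 \<le> \<kappa>" "\<kappa> * (9 / 4 * M\<^sup>2) \<le> 1"
  proof -
    show "0 \<le> \<kappa>" using tau ab by (simp add: \<kappa>_def)
    have "\<kappa> * (9 / 4 * M\<^sup>2) = 3 / 4 * (\<tau> * (3 * M\<^sup>2)) / b"
      by (simp add: \<kappa>_def)
    also have "\<dots> \<le> 1"
      unfolding M2 using b_large ab(2) by simp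
    finally show "\<kappa> * (9 / 4 * M\<^sup>2) \<le> 1" .
  qed
  have [measurable]: "u \<in> borel_measurable torus_measure" by (rule u(1))
  have meas: "(\<lambda>x. g (u x)) \<in> borel_measurable torus_measure"
    "(\<lambda>x. u x - \<kappa> * g (u x)) \<in> borel_measurable torus_measure"
    unfolding g by measurable
  have gM: "AE x in torus_measure. \<bar>g (u x)\<bar> \<le> 2 * M ^ 3"
    using u(2) by eventually_elim (simp add: g cubic_increasing_bound)
  have hM: "AE x in torus_measure. \<bar>u x - \<kappa> * g (u x)\<bar> \<le> M - \<kappa> * (2 * M ^ 3)"
    using u(2) by eventually_elim (simp only: g, rule cubic_remainder_bound[OF _ \<kappa>])
  have u_int: "integrable torus_measure u"
    by (rule finite_measure.integrable_const_bound[OF finite_measure_torus _ u(1)]) (use u(2) in simp)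
  moreover have "integrable torus_measure (\<lambda>x. g (u x))"
    by (rule finite_measure.integrable_const_bound[OF finite_measure_torus _ meas(1)]) (use gM in simp)
  ultimately have "integrable torus_measure (\<lambda>x. A * u x - g (u x))"
    by simp
  then have f_int: "integrable torus_measure (\<lambda>x. nonlin (u x))"
    by (simp add: g_def)
  have v: "integrable torus_measure v"
    using step by (simp add: scheme_step_def)
  have bound: "\<bar>\<integral>x. v x * \<psi> x \<partial>torus_measure\<bar> \<le> M * (\<integral>x. \<psi> x \<partial>torus_measure)"
    if \<psi>: "trig_poly \<psi>" "\<And>x. 0 \<le> \<psi> x" for \<psi>
  proof -
    obtain \<eta> where \<eta>: "trig_poly \<eta>" "\<And>x. \<eta> x - a * laplacian \<eta> x = \<psi> x"
      using trig_poly_resolvent[OF ab(1) \<psi>(1)] by blast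
    obtain \<phi> where \<phi>: "trig_poly \<phi>" "\<And>x. \<phi> x - b * laplacian \<phi> x = \<eta> x"
      using trig_poly_resolvent[OF less_imp_le[OF ab(2)] \<eta>(1)] by blast
    have \<eta>_nonneg: "0 \<le> \<eta> x" for x
      using trig_poly_resolvent_nonneg[OF \<eta>(1) ab(1)] \<eta>(2) \<psi>(2) by simp
    have \<phi>_nonneg: "0 \<le> \<phi> x" for x
      using trig_poly_resolvent_nonneg[OF \<phi>(1) less_imp_le[OF ab(2)]] \<phi>(2) \<eta>_nonneg by simp
    let ?m = "\<integral>x. \<psi> x \<partial>torus_measure"
    have mass: "(\<integral>x. \<eta> x \<partial>torus_measure) = ?m" "(\<integral>x. \<phi> x \<partial>torus_measure) = ?m"
      using integral_resolvent[OF \<eta>] integral_resolvent[OF \<phi>] by simp_all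
    have "(\<integral>x. v x * \<psi> x \<partial>torus_measure) = (\<integral>x. (u x - \<kappa> * g (u x)) * \<phi> x \<partial>torus_measure)
        + \<kappa> * (\<integral>x. g (u x) * \<eta> x \<partial>torus_measure)"
      unfolding \<kappa>_def g_def
      by (rule scheme_step_factored[OF step _ _ ab(3,4) u_int f_int \<phi> \<eta>(2)]) (use tau ab in auto)
    also have "\<bar>\<dots>\<bar> \<le> \<bar>\<integral>x. (u x - \<kappa> * g (u x)) * \<phi> x \<partial>torus_measure\<bar>
        + \<kappa> * \<bar>\<integral>x. g (u x) * \<eta> x \<partial>torus_measure\<bar>"
      using \<kappa>(1) by (simp add: abs_mult order_trans[OF abs_triangle_ineq])
    \<comment> \<open>\<phi> and \<eta> are nonnegative and share the mass of \<psi>, so the two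
      pointwise bounds can be added; the contributions \<kappa> * 2 M^3 cancel and leave M.\<close>
    also have "\<dots> \<le> (M - \<kappa> * (2 * M ^ 3)) * ?m + \<kappa> * (2 * M ^ 3 * ?m)"
      using abs_integral_mult_le[OF meas(2) hM \<phi>(1) \<phi>_nonneg]
        abs_integral_mult_le[OF meas(1) gM \<eta>(1) \<eta>_nonneg] \<kappa>(1)
      unfolding mass by (intro add_mono mult_left_mono)
    also have "\<dots> = M * ?m" by (simp add: algebra_simps)
    finally show ?thesis .
  qed
  \<comment> \<open>c = 1 and c = -1 yield the upper and the lower bound on v.\<close>
  have one_sided: "AE x in torus_measure. 0 \<le> M - c * v x" if c: "\<bar>c\<bar> = 1" for c
  proof (rule AE_nonneg_if_trig_poly_nonneg)
    show "integrable torus_measure (\<lambda>x. M - c * v x)"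
      using v integrable_const_torus by (intro Bochner_Integration.integrable_diff integrable_mult_right)
    fix \<psi> :: "real ^ 'd \<Rightarrow> real" assume \<psi>: "trig_poly \<psi>" "\<And>x. 0 \<le> \<psi> x"
    have "(\<integral>x. (M - c * v x) * \<psi> x \<partial>torus_measure) = (\<integral>x. M * \<psi> x - c * (v x * \<psi> x) \<partial>torus_measure)"
      by (simp add: algebra_simps)
    also have "\<dots> = M * (\<integral>x. \<psi> x \<partial>torus_measure) - c * (\<integral>x. v x * \<psi> x \<partial>torus_measure)"
      using integrable_trig_poly[OF \<psi>(1)] integrable_mult_trig_poly[OF \<psi>(1) v] by simp
    also have "0 \<le> \<dots>"
    proof -
      have "c * (\<integral>x. v x * \<psi> x \<partial>torus_measure) \<le> \<bar>\<integral>x. v x * \<psi> x \<partial>torus_measure\<bar>"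
        using abs_ge_self[of "c * (\<integral>x. v x * \<psi> x \<partial>torus_measure)"] by (simp add: abs_mult c)
      with bound[OF \<psi>] show ?thesis by linarith
    qed
    finally show "0 \<le> (\<integral>x. (M - c * v x) * \<psi> x \<partial>torus_measure)" .
  qed
  from one_sided[of 1, simplified] one_sided[of "-1", simplified]
  show ?thesis by eventually_elim (simp add: abs_le_iff)
qed

text \<open>Translates between the norm of the theorem and the almost-everywhere bounds on which the
  induction runs. Measurability enters in the passage from the pointwise bound to the essential
  supremum.\<close>

lemma Linf_norm_le_iff:
  assumes "w \<in> borel_measurable torus_measure"
  shows "Linf_norm w \<le> ereal M \<longleftrightarrow> (AE x in torus_measure. \<bar>w x\<bar> \<le> M)"
proof
  assume "Linf_norm w \<le> ereal M"
  moreover have "AE x in torus_measure. ereal \<bar>w x\<bar> \<le> Linf_norm w"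
    unfolding Linf_norm_def by (rule esssup_AE)
  ultimately show "AE x in torus_measure. \<bar>w x\<bar> \<le> M"
    by (auto elim!: eventually_mono dest: order_trans)
next
  assume "AE x in torus_measure. \<bar>w x\<bar> \<le> M"
  with assms show "Linf_norm w \<le> ereal M"
    unfolding Linf_norm_def by (intro esssup_I) auto
qed

theorem theorem1p1:
  fixes u :: "nat \<Rightarrow> real ^ 'd \<Rightarrow> real" and \<nu> \<tau> A M :: real
  assumes dim: "CARD('d) \<in> {1, 2, 3}"
    and nu: "\<nu> > 0" and tau: "\<tau> > 0"
    and u0_periodic: "torus_periodic (u 0)"
    and u0_measurable: "u 0 \<in> borel_measurable torus_measure"
    and u0_bounded: "bounded (range (u 0))"
    and u0_mean_zero: "(\<integral>x. u 0 x \<partial>torus_measure) = 0"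
    and scheme: "\<forall>n. scheme_step \<nu> \<tau> A (u n) (u (Suc n))"
    and A_cr: "A \<ge> 1 + 2 * sqrt (1 + 4 / 3 * (\<nu> / \<tau>))"
    and M: "M = sqrt ((A + 1) / 3)"
    and u0_bound: "Linf_norm (u 0) \<le> ereal M"
  shows "\<forall>n\<ge>1. Linf_norm (u n) \<le> ereal M"
proof -
  \<comment> \<open>The initial datum is measurable by hypothesis, every later iterate because a
    scheme step yields an integrable function.\<close>
  have meas: "u n \<in> borel_measurable torus_measure" for n
    using u0_measurable scheme by (cases n) (auto simp: scheme_step_def)
  have "AE x in torus_measure. \<bar>u n x\<bar> \<le> M" for n
  proof (induction n)
    case 0
    show ?case using u0_bound Linf_norm_le_iff[OF meas] by blast
  next
    case (Suc n)
    show ?case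
      using scheme_step_max_principle[OF nu tau A_cr M meas Suc] scheme by blast
  qed
  then show ?thesis using Linf_norm_le_iff[OF meas] by blast
qed

end
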